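(* Let $B\in M_n(\mathbb K)$ be diagonalizable, and let $B'\in M_n(\mathbb K)$ have the same eigenvalues as $B$ counting multiplicities, i.e., $p_{B'}(x)=p_B(x)$. If $B$ is integrable, then $B'$ is integrable.
   Context: $\mathbb K$ is an algebraically closed subfield of $\mathbb C$; $M_n(\mathbb K)$ is the set of $n\times n$ matrices over $\mathbb K$; $\mathbb K^n$ is the set of row vectors of length $n$. For a square matrix $X$, $p_X(x)=\det(xI-X)$ is its characteristic polynomial. For $B\in M_n(\mathbb K)$, a matrix $A\in M_{n+1}(\mathbb K)$ is called an integral of $B$ if there exist $u,v\in\mathbb K^n$ and $b\in\mathbb K$ such that $A=\begin{pmatrix} B & u^{\top}\\ v & b\end{pmatrix}$ and $p_B(x)=\frac{1}{n+1}p_A'(x)$. The matrix $B$ is integrable if there exists an integral of $B$. *)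

theory Defs
  imports Complex_Main "Jordan_Normal_Form.Char_Poly"
begin

definition alg_closed_subfield :: "complex set \<Rightarrow> bool" where
  "alg_closed_subfield K \<longleftrightarrow>
     0 \<in> K \<and> 1 \<in> K \<and>
     (\<forall>x\<in>K. \<forall>y\<in>K. x + y \<in> K \<and> x * y \<in> K) \<and>
     (\<forall>x\<in>K. - x \<in> K \<and> inverse x \<in> K) \<and>
     (\<forall>p :: complex poly. range (coeff p) \<subseteq> K \<and> degree p > 0 \<longrightarrow> (\<exists>x\<in>K. poly p x = 0))"

definition mats_over :: "complex set \<Rightarrow> nat \<Rightarrow> complex mat set" where
  "mats_over K n = {A \<in> carrier_mat n n. elements_mat A \<subseteq> K}"

definition vecs_over :: "complex set \<Rightarrow> nat \<Rightarrow> complex vec set" where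
  "vecs_over K n = {v \<in> carrier_vec n. set\<^sub>v v \<subseteq> K}"

text \<open>Diagonalizability over \<open>K\<close>: the diagonal matrix, the transition matrix and its inverse
  are all required to have entries in \<open>K\<close>.\<close>

definition diagonalizable_over :: "complex set \<Rightarrow> nat \<Rightarrow> complex mat \<Rightarrow> bool" where
  "diagonalizable_over K n B \<longleftrightarrow>
     (\<exists>D \<in> mats_over K n. \<exists>P \<in> mats_over K n. \<exists>Q \<in> mats_over K n.
        diagonal_mat D \<and> similar_mat_wit B D P Q)"

text \<open>\<open>bordered B u v b\<close> is the block matrix with first block row \<open>B, u\<^sup>T\<close> and second
  block row \<open>v, b\<close>, for row vectors \<open>u\<close> and \<open>v\<close>.\<close>

definition bordered :: "complex mat \<Rightarrow> complex vec \<Rightarrow> complex vec \<Rightarrow> complex \<Rightarrow> complex mat" where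
  "bordered B u v b =
     four_block_mat B (transpose_mat (mat_of_row u)) (mat_of_row v) (mat 1 1 (\<lambda>_. b))"

definition is_integral :: "complex set \<Rightarrow> nat \<Rightarrow> complex mat \<Rightarrow> complex mat \<Rightarrow> bool" where
  "is_integral K n B A \<longleftrightarrow>
     A \<in> mats_over K (n + 1) \<and>
     (\<exists>u \<in> vecs_over K n. \<exists>v \<in> vecs_over K n. \<exists>b \<in> K. A = bordered B u v b) \<and>
     char_poly B = Polynomial.smult (1 / of_nat (n + 1)) (pderiv (char_poly A))"

definition integrable_mat :: "complex set \<Rightarrow> nat \<Rightarrow> complex mat \<Rightarrow> bool" where
  "integrable_mat K n B \<longleftrightarrow> (\<exists>A. is_integral K n B A)"

end

theory Submission
  imports Defs
begin

text \<open>If \<open>u = \<Sum> w\<^sub>i\<close> with \<open>B w\<^sub>i = d\<^sub>i w\<^sub>i\<close>, then bordering \<open>B\<close> by \<open>u, v, b\<close> multiplies \<open>p\<^sub>B(x)\<close> by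
  \<open>x - b - \<Sum> (v \<bullet> w\<^sub>i) / (x - d\<^sub>i)\<close>. For diagonalizable \<open>B\<close> every \<open>u\<close> is such a sum, so the correction
  term of an integral of \<open>B\<close> is \<open>\<Sum> c\<^sub>\<alpha> / (x - \<alpha>)\<close> over the distinct eigenvalues \<open>\<alpha>\<close>: it has only simple
  poles. Such a term can be realised for any \<open>B'\<close> with the same spectrum: take for \<open>u'\<close> the sum of one
  eigenvector over \<open>K\<close> per eigenvalue, and for \<open>v'\<close> a functional over \<open>K\<close> with value \<open>c\<^sub>\<alpha>\<close> on the
  eigenvector for \<open>\<alpha>\<close>.\<close>

section \<open>Entrywise membership in \<open>K\<close>\<close>

lemma mats_over_iff:
  "A \<in> mats_over K n \<longleftrightarrow> A \<in> carrier_mat n n \<and> (\<forall>i<n. \<forall>j<n. A $$ (i,j) \<in> K)"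
  unfolding mats_over_def by (auto intro: elements_matI)

lemma vecs_over_iff:
  "v \<in> vecs_over K n \<longleftrightarrow> v \<in> carrier_vec n \<and> (\<forall>i<n. v $ i \<in> K)"
  unfolding vecs_over_def vec_set_def by auto

section \<open>Determinants and characteristic polynomials of bordered matrices\<close>

text \<open>If the last column has the form \<open>M *\<^sub>v y\<close>, subtracting the
  combination \<open>y\<close> of the first \<open>n\<close> columns clears it. This is right
  multiplication by the unipotent block matrix \<open>?E\<close>, so \<open>M\<close> may be
  singular and no inverse enters.\<close>

lemma det_bordered_solution:
  fixes M :: "'a :: idom mat"
  assumes M: "M \<in> carrier_mat n n" and y: "y \<in> carrier_vec n" and v: "v \<in> carrier_vec n"
    and b: "b \<in> carrier_mat 1 1"
  shows "det (four_block_mat M (mat_of_cols n [M *\<^sub>v y]) (mat_of_row v) b)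
    = det M * (b $$ (0,0) - v \<bullet> y)"
proof -
  let ?y = "mat_of_cols n [y]" and ?F = "four_block_mat M (mat_of_cols n [M *\<^sub>v y]) (mat_of_row v) b"
  let ?E = "four_block_mat (1\<^sub>m n) (- ?y) (0\<^sub>m 1 n) (1\<^sub>m 1)"
  let ?d = "mat 1 1 (\<lambda>_. b $$ (0,0) - v \<bullet> y)"
  have My: "M *\<^sub>v y \<in> carrier_vec n" using M y by simp
  have c: "mat_of_cols n [M *\<^sub>v y] \<in> carrier_mat n 1" "?y \<in> carrier_mat n 1"
    "mat_of_row v \<in> carrier_mat 1 n" using v by (auto simp: mat_of_row_def mat_of_cols_def)
  have "?F * ?E = four_block_mat (M * 1\<^sub>m n + mat_of_cols n [M *\<^sub>v y] * 0\<^sub>m 1 n)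
     (M * (- ?y) + mat_of_cols n [M *\<^sub>v y] * 1\<^sub>m 1)
     (mat_of_row v * 1\<^sub>m n + b * 0\<^sub>m 1 n) (mat_of_row v * (- ?y) + b * 1\<^sub>m 1)"
    by (rule mult_four_block_mat) (use M c b in auto)
  also have "M * 1\<^sub>m n + mat_of_cols n [M *\<^sub>v y] * 0\<^sub>m 1 n = M" using M c by auto
  also have "M * (- ?y) + mat_of_cols n [M *\<^sub>v y] * 1\<^sub>m 1 = 0\<^sub>m n 1"
  proof -
    have "M * ?y = mat_of_cols n [M *\<^sub>v y]"
      by (rule eq_matI) (use M y in \<open>auto simp: mat_of_cols_def scalar_prod_def\<close>)
    moreover have "M * (- ?y) = - (M * ?y)"
      by (rule eq_matI) (use M c in \<open>auto simp: scalar_prod_def sum_negf\<close>)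
    moreover have "mat_of_cols n [M *\<^sub>v y] * 1\<^sub>m 1 = mat_of_cols n [M *\<^sub>v y]"
      using c(1) by simp
    ultimately show ?thesis using c(1) by auto
  qed
  also have "mat_of_row v * 1\<^sub>m n + b * 0\<^sub>m 1 n = mat_of_row v" using c b by auto
  also have "mat_of_row v * (- ?y) + b * 1\<^sub>m 1 = ?d"
    by (rule eq_matI)
      (use v y b in \<open>auto simp: mat_of_row_def mat_of_cols_def scalar_prod_def sum_negf\<close>)
  finally have FE: "?F * ?E = four_block_mat M (0\<^sub>m n 1) (mat_of_row v) ?d" .
  have "det ?E = det (1\<^sub>m n :: 'a mat) * det (1\<^sub>m 1 :: 'a mat)"
    by (rule det_four_block_mat_lower_left_zero) (use c in auto)
  moreover have "det (?F * ?E) = det ?F * det ?E"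
    by (rule det_mult[of _ "n + 1"]) (use M b in auto)
  moreover have "det (?F * ?E) = det M * det ?d"
    unfolding FE by (rule det_four_block_mat_upper_right_zero) (use M c in auto)
  ultimately show ?thesis by (simp add: det_single)
qed

text \<open>The \<open>d i\<close> may repeat and the \<open>w i\<close> may vanish, so the formula
  covers both the decomposition of a border along a diagonalization, indexed by columns, and a
  border with one eigenvector per eigenvalue of a possibly non-diagonalizable matrix.\<close>

lemma poly_char_poly_bordered:
  fixes B :: "complex mat"
  assumes B: "B \<in> carrier_mat n n" and v: "v \<in> carrier_vec n" and I: "finite I"
    and w: "\<And>i. i \<in> I \<Longrightarrow> w i \<in> carrier_vec n"
    and eig: "\<And>i. i \<in> I \<Longrightarrow> B *\<^sub>v w i = d i \<cdot>\<^sub>v w i"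
    and x: "x \<notin> d ` I"
  shows "poly (char_poly (bordered B (vec n (\<lambda>k. \<Sum>i\<in>I. w i $ k)) v b)) x
    = poly (char_poly B) x * (x - b - (\<Sum>i\<in>I. (v \<bullet> w i) / (x - d i)))"
proof -
  let ?u = "vec n (\<lambda>k. \<Sum>i\<in>I. w i $ k)"
  define M where "M = - char_matrix B x"
  \<comment> \<open>As \<open>M\<close> is x I - B, it multiplies \<open>w i\<close> by
    \<open>x - d i\<close>. Dividing each summand of the border by this factor therefore solves M y
    = -u.\<close>
  define y where "y = vec n (\<lambda>k. - (\<Sum>i\<in>I. w i $ k / (x - d i)))"
  let ?b = "mat 1 1 (\<lambda>_. x - b)"
  have M: "M \<in> carrier_mat n n" and y: "y \<in> carrier_vec n" using B by (auto simp: M_def y_def)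
  have Bw: "(\<Sum>j = 0..<n. B $$ (k,j) * w i $ j) = d i * w i $ k" if "i \<in> I" "k < n" for i k
  proof -
    have "(B *\<^sub>v w i) $ k = (d i \<cdot>\<^sub>v w i) $ k" using eig that by simp
    then show ?thesis using w[OF that(1)] that B by (auto simp: scalar_prod_def)
  qed
  have My: "M *\<^sub>v y = - ?u"
  proof (rule eq_vecI)
    fix k assume "k < dim_vec (- ?u)"
    then have k: "k < n" by simp
    have Mj: "M $$ (k,j) = (if k = j then x else 0) - B $$ (k,j)" if "j < n" for j
      using B k that by (auto simp: M_def char_matrix_def)
    have "(M *\<^sub>v y) $ k = (\<Sum>j = 0..<n. M $$ (k,j) * y $ j)"
      using k M y by (auto simp: scalar_prod_def)
    also have "\<dots> = (\<Sum>j = 0..<n. (if k = j then x * y $ j else 0) - B $$ (k,j) * y $ j)"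
      by (rule sum.cong) (auto simp: Mj algebra_simps)
    also have "\<dots> = x * y $ k - (\<Sum>j = 0..<n. B $$ (k,j) * y $ j)"
      using k by (simp add: sum_subtractf sum.delta)
    also have "(\<Sum>j = 0..<n. B $$ (k,j) * y $ j)
        = - (\<Sum>j = 0..<n. \<Sum>i\<in>I. B $$ (k,j) * w i $ j / (x - d i))"
      by (simp add: y_def sum_distrib_left sum_negf)
    also have "(\<Sum>j = 0..<n. \<Sum>i\<in>I. B $$ (k,j) * w i $ j / (x - d i))
        = (\<Sum>i\<in>I. (\<Sum>j = 0..<n. B $$ (k,j) * w i $ j) / (x - d i))"
      by (subst sum.swap) (simp add: sum_divide_distrib)
    also have "\<dots> = (\<Sum>i\<in>I. d i * w i $ k / (x - d i))"
      by (rule sum.cong) (simp_all add: Bw k)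
    also have "x * y $ k - - \<dots> = - (\<Sum>i\<in>I. (x * w i $ k - d i * w i $ k) / (x - d i))"
      using k by (simp add: y_def sum_distrib_left diff_divide_distrib sum_subtractf)
    also have "(\<Sum>i\<in>I. (x * w i $ k - d i * w i $ k) / (x - d i)) = (\<Sum>i\<in>I. w i $ k)"
    proof (rule sum.cong[OF refl])
      fix i assume "i \<in> I"
      then have "x - d i \<noteq> 0" using x by auto
      then show "(x * w i $ k - d i * w i $ k) / (x - d i) = w i $ k"
        by (simp add: left_diff_distrib[symmetric])
    qed
    finally show "(M *\<^sub>v y) $ k = (- ?u) $ k" using k by simp
  qed (use M in auto)
  have bord: "bordered B ?u v b \<in> carrier_mat (n + 1) (n + 1)"
    unfolding bordered_def by (rule four_block_carrier_mat) (use B in auto)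
  \<comment> \<open>The borders of x I minus the bordered matrix are -u and -v. The column -u is
    \<open>M *\<^sub>v y\<close>, and the sign of -v cancels the one in \<open>y\<close>.\<close>
  have "- char_matrix (bordered B ?u v b) x
      = four_block_mat M (mat_of_cols n [M *\<^sub>v y]) (mat_of_row (- v)) ?b"
    unfolding My
    by (rule eq_matI) (use B M v in \<open>auto simp: bordered_def char_matrix_def M_def mat_of_row_def
        mat_of_cols_def\<close>)
  then have "poly (char_poly (bordered B ?u v b)) x
      = det (four_block_mat M (mat_of_cols n [M *\<^sub>v y]) (mat_of_row (- v)) ?b)"
    using char_poly_matrix[OF bord] by simp
  also have "\<dots> = det M * (?b $$ (0,0) - (- v) \<bullet> y)"
    by (rule det_bordered_solution) (use M y v in auto)
  also have "(- v) \<bullet> y = (\<Sum>j = 0..<n. \<Sum>i\<in>I. v $ j * w i $ j / (x - d i))"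
    using v by (simp add: scalar_prod_def y_def sum_distrib_left sum_negf)
  also have "\<dots> = (\<Sum>i\<in>I. (v \<bullet> w i) / (x - d i))"
    by (subst sum.swap, rule sum.cong)
      (use v w[THEN carrier_vecD] in \<open>auto simp: scalar_prod_def sum_divide_distrib\<close>)
  also have "det M = poly (char_poly B) x" using char_poly_matrix[OF B] by (simp add: M_def)
  finally show ?thesis by simp
qed

section \<open>Eigenvectors with entries in the subfield\<close>

context
  fixes K :: "complex set"
  assumes K: "alg_closed_subfield K"
begin

lemma subfield_closed:
  shows "0 \<in> K" "1 \<in> K"
    and "\<And>x y. x \<in> K \<Longrightarrow> y \<in> K \<Longrightarrow> x + y \<in> K"
    and "\<And>x y. x \<in> K \<Longrightarrow> y \<in> K \<Longrightarrow> x * y \<in> K"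
    and "\<And>x y. x \<in> K \<Longrightarrow> y \<in> K \<Longrightarrow> x - y \<in> K"
    and "\<And>x y. x \<in> K \<Longrightarrow> y \<in> K \<Longrightarrow> x / y \<in> K"
    and "\<And>x. x \<in> K \<Longrightarrow> - x \<in> K"
proof -
  show *: "0 \<in> K" "1 \<in> K" "\<And>x y. x \<in> K \<Longrightarrow> y \<in> K \<Longrightarrow> x + y \<in> K"
    "\<And>x y. x \<in> K \<Longrightarrow> y \<in> K \<Longrightarrow> x * y \<in> K" "\<And>x. x \<in> K \<Longrightarrow> - x \<in> K"
    using K unfolding alg_closed_subfield_def by blast+
  show "x - y \<in> K" if "x \<in> K" "y \<in> K" for x y
    using *(3)[OF that(1) *(5)[OF that(2)]] by simp
  show "x / y \<in> K" if "x \<in> K" "y \<in> K" for x y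
    using K that unfolding alg_closed_subfield_def divide_inverse by blast
qed

lemma sum_in_subfield: "(\<And>i. i \<in> I \<Longrightarrow> f i \<in> K) \<Longrightarrow> sum f I \<in> K"
  by (induction I rule: infinite_finite_induct) (auto intro: subfield_closed)

lemma scalar_prod_in_subfield:
  "v \<in> vecs_over K n \<Longrightarrow> w \<in> vecs_over K n \<Longrightarrow> v \<bullet> w \<in> K"
  unfolding vecs_over_iff scalar_prod_def by (auto intro!: sum_in_subfield subfield_closed)

lemma mult_mat_vec_over:
  assumes "A \<in> mats_over K n" "v \<in> vecs_over K n"
  shows "A *\<^sub>v v \<in> vecs_over K n"
  using assms unfolding vecs_over_iff mats_over_iff
  by (auto simp: scalar_prod_def intro!: sum_in_subfield subfield_closed)

text \<open>The values \<open>y\<close> are the images of the \<open>z i\<close> under a \<open>K\<close>-linear map from their span to \<open>K\<close>,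
  extended one generator at a time.\<close>

lemma linear_relation_descent:
  fixes z :: "'i \<Rightarrow> complex"
  assumes F: "finite F" and z0: "z i0 \<noteq> 0"
  shows "\<exists>y. y i0 = 1 \<and> (\<forall>i\<in>insert i0 F. y i \<in> K) \<and>
    (\<forall>c. (\<forall>i\<in>insert i0 F. c i \<in> K) \<longrightarrow> (\<Sum>i\<in>insert i0 F. c i * z i) = 0 \<longrightarrow>
      (\<Sum>i\<in>insert i0 F. c i * y i) = 0)"
  using F
proof (induction F)
  case empty
  \<comment> \<open>A relation \<open>c i0 * z i0 = 0\<close> forces \<open>c i0 = 0\<close>, so the
    value 1 is admissible.\<close>
  show ?case using z0 by (intro exI[of _ "\<lambda>_. 1"]) (auto intro: subfield_closed)
next
  case (insert j F)
  let ?G = "insert i0 F"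
  from insert.IH obtain y where y: "y i0 = 1" "\<And>i. i \<in> ?G \<Longrightarrow> y i \<in> K"
    and rel: "\<And>c. (\<And>i. i \<in> ?G \<Longrightarrow> c i \<in> K) \<Longrightarrow> (\<Sum>i\<in>?G. c i * z i) = 0 \<Longrightarrow>
      (\<Sum>i\<in>?G. c i * y i) = 0" by metis
  show ?case
  proof (cases "j = i0")
    \<comment> \<open>The family may contain \<open>i0\<close> itself; its value stays 1.\<close>
    case True
    then show ?thesis using insert.IH by (simp add: insert_absorb)
  next
    case False
    then have j: "j \<notin> ?G" using insert.hyps by auto
    have fin: "finite ?G" using insert.hyps by auto
    have eq: "insert i0 (insert j F) = insert j ?G" by auto
    \<comment> \<open>\<open>t\<close> is to be the image of \<open>z j\<close>. It is forced if
      \<open>z j\<close> lies in the \<open>K\<close>-span of the earlier values; otherwise every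
      relation has \<open>c j = 0\<close> and any value, here 0, will do.\<close>
    have "\<exists>t\<in>K. \<forall>c. (\<forall>i\<in>insert j ?G. c i \<in> K) \<longrightarrow> (\<Sum>i\<in>?G. c i * z i) + c j * z j = 0 \<longrightarrow>
        (\<Sum>i\<in>?G. c i * y i) + c j * t = 0"
    proof (cases "\<exists>a. (\<forall>i\<in>?G. a i \<in> K) \<and> z j = (\<Sum>i\<in>?G. a i * z i)")
      case True
      then obtain a where a: "\<forall>i\<in>?G. a i \<in> K" "z j = (\<Sum>i\<in>?G. a i * z i)" by blast
      show ?thesis
      proof (intro bexI[of _ "\<Sum>i\<in>?G. a i * y i"] allI impI)
        fix c assume c: "\<forall>i\<in>insert j ?G. c i \<in> K" "(\<Sum>i\<in>?G. c i * z i) + c j * z j = 0"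
        \<comment> \<open>Substituting the combination for \<open>z j\<close> turns the relation
          into one among the earlier values, with coefficients
          \<open>c i + c j * a i\<close>.\<close>
        have "(\<Sum>i\<in>?G. (c i + c j * a i) * y i) = 0"
          by (rule rel) (use a(1) c in \<open>auto intro: subfield_closed
            simp del: sum.insert simp: distrib_right sum.distrib a(2) sum_distrib_left mult.assoc\<close>)
        then show "(\<Sum>i\<in>?G. c i * y i) + c j * (\<Sum>i\<in>?G. a i * y i) = 0"
          by (simp del: sum.insert add: distrib_right sum.distrib sum_distrib_left mult.assoc)
      qed (use a y in \<open>blast intro: sum_in_subfield subfield_closed\<close>)
    next
      case no: False
      show ?thesis
      proof (intro bexI[of _ 0] allI impI)
        fix c assume c: "\<forall>i\<in>insert j ?G. c i \<in> K" "(\<Sum>i\<in>?G. c i * z i) + c j * z j = 0"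
        have "c j = 0"
        proof (rule ccontr)
          assume cj: "c j \<noteq> 0"
          have "c j * z j = - (\<Sum>i\<in>?G. c i * z i)" using c(2) by (metis add.commute eq_neg_iff_add_eq_0)
          then have "z j = (\<Sum>i\<in>?G. (- c i / c j) * z i)" using cj
            by (simp del: sum.insert add: field_simps sum_negf sum_divide_distrib[symmetric])
          moreover have "\<forall>i\<in>?G. - c i / c j \<in> K" using c(1) by (auto intro!: subfield_closed)
          ultimately have "\<exists>a. (\<forall>i\<in>?G. a i \<in> K) \<and> z j = (\<Sum>i\<in>?G. a i * z i)"
            by (intro exI[of _ "\<lambda>i. - c i / c j"] conjI)
          with no show False by contradiction
        qed
        with c have "(\<Sum>i\<in>?G. c i * y i) = 0"
          by (intro rel) (auto simp del: sum.insert)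
        then show "(\<Sum>i\<in>?G. c i * y i) + c j * 0 = 0" by simp
      qed (rule subfield_closed)
    qed
    then obtain t where t: "t \<in> K" "\<And>c. (\<forall>i\<in>insert j ?G. c i \<in> K) \<Longrightarrow>
      (\<Sum>i\<in>?G. c i * z i) + c j * z j = 0 \<Longrightarrow> (\<Sum>i\<in>?G. c i * y i) + c j * t = 0" by blast
    define y' where "y' = y(j := t)"
    have y'_G: "y' i = y i" if "i \<in> ?G" for i using j that by (auto simp: y'_def)
    then have y'_sum: "(\<Sum>i\<in>?G. c i * y' i) = (\<Sum>i\<in>?G. c i * y i)" for c
      by (intro sum.cong) auto
    have y'_j: "y' j = t" by (simp add: y'_def)
    show ?thesis
      unfolding eq sum.insert[OF fin j]
    proof (intro exI[of _ y'] conjI allI impI)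
      show "y' i0 = 1" using y'_G y(1) by simp
      show "\<forall>i\<in>insert j ?G. y' i \<in> K" using y'_G y'_j y(2) t(1) by auto
      fix c assume "\<forall>i\<in>insert j ?G. c i \<in> K" "c j * z j + (\<Sum>i\<in>?G. c i * z i) = 0"
      then show "c j * y' j + (\<Sum>i\<in>?G. c i * y' i) = 0"
        unfolding y'_sum y'_j using t(2)[of c] by (simp only: add.commute)
    qed
  qed
qed

text \<open>Each row of the eigenvector equation is a linear relation, with coefficients in
  \<open>K\<close>, among the coordinates of a complex eigenvector. Replacing the coordinates by
  their images in \<open>K\<close> preserves all these relations, and an image equal to 1 keeps the
  vector nonzero.\<close>

lemma eigenvector_over:
  assumes A: "A \<in> mats_over K n" and \<alpha>: "\<alpha> \<in> K" and root: "poly (char_poly A) \<alpha> = 0"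
  shows "\<exists>w \<in> vecs_over K n. eigenvector A w \<alpha>"
proof -
  have Ac: "A \<in> carrier_mat n n" using A by (simp add: mats_over_iff)
  then obtain z where z: "z \<in> carrier_vec n" "z \<noteq> 0\<^sub>v n" "A *\<^sub>v z = \<alpha> \<cdot>\<^sub>v z"
    using root eigenvalue_root_char_poly[OF Ac] by (auto simp: eigenvalue_def eigenvector_def)
  then obtain i0 where i0: "i0 < n" "z $ i0 \<noteq> 0" by (metis eq_vecI carrier_vecD index_zero_vec)
  have ins: "insert i0 {0..<n} = {0..<n}" using i0 by auto
  from linear_relation_descent[of "{0..<n}" "($) z", OF _ i0(2), unfolded ins]
  obtain y where y: "y i0 = 1" "\<And>i. i < n \<Longrightarrow> y i \<in> K"
    and rel: "\<And>c. (\<And>i. i < n \<Longrightarrow> c i \<in> K) \<Longrightarrow> (\<Sum>i = 0..<n. c i * z $ i) = 0 \<Longrightarrow>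
      (\<Sum>i = 0..<n. c i * y i) = 0"
    by auto
  \<comment> \<open>Row \<open>k\<close> of A - \<alpha> I as a single sum, the shape in which
    \<open>rel\<close> applies.\<close>
  have lin: "(\<Sum>j = 0..<n. (A $$ (k,j) - (if j = k then \<alpha> else 0)) * f j)
      = (\<Sum>j = 0..<n. A $$ (k,j) * f j) - \<alpha> * f k" if "k < n" for k and f :: "nat \<Rightarrow> complex"
  proof -
    have "(\<Sum>j = 0..<n. (A $$ (k,j) - (if j = k then \<alpha> else 0)) * f j)
      = (\<Sum>j = 0..<n. A $$ (k,j) * f j - (if j = k then \<alpha> * f j else 0))"
      by (rule sum.cong) (auto simp: algebra_simps)
    then show ?thesis using that by (simp add: sum_subtractf)
  qed
  have "(\<Sum>j = 0..<n. A $$ (k,j) * y j) = \<alpha> * y k" if k: "k < n" for k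
  proof -
    have "(A *\<^sub>v z) $ k = (\<alpha> \<cdot>\<^sub>v z) $ k" using z(3) by simp
    then have "(\<Sum>j = 0..<n. A $$ (k,j) * z $ j) = \<alpha> * z $ k"
      using k Ac z(1) by (auto simp: scalar_prod_def)
    then have "(\<Sum>j = 0..<n. (A $$ (k,j) - (if j = k then \<alpha> else 0)) * y j) = 0"
      using A \<alpha> k by (intro rel) (auto simp: lin mats_over_iff intro: subfield_closed)
    then show ?thesis using lin[OF k, of y] by simp
  qed
  then have "A *\<^sub>v vec n y = \<alpha> \<cdot>\<^sub>v vec n y"
    using Ac by (intro eq_vecI) (auto simp: scalar_prod_def)
  moreover have "vec n y \<noteq> 0\<^sub>v n" using y(1) i0(1) by (metis index_vec index_zero_vec(1) zero_neq_one)
  ultimately have "eigenvector A (vec n y) \<alpha>" using Ac by (auto simp: eigenvector_def)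
  moreover have "vec n y \<in> vecs_over K n" using y(2) by (auto simp: vecs_over_iff)
  ultimately show ?thesis by blast
qed

section \<open>Functionals over \<open>K\<close> on eigenvectors for distinct eigenvalues\<close>

text \<open>Multiplying a functional by \<open>A - \<nu>\<close> kills the eigenvector for \<open>\<nu>\<close> and rescales the others
  by nonzero factors.\<close>

lemma separating_functional:
  assumes A: "A \<in> mats_over K n" and w: "\<And>\<alpha>. \<alpha> \<in> insert \<mu> S \<Longrightarrow> eigenvector A (w \<alpha>) \<alpha>"
    and S: "finite S" "\<mu> \<notin> S" "S \<subseteq> K"
  shows "\<exists>f \<in> vecs_over K n. f \<bullet> w \<mu> \<noteq> 0 \<and> (\<forall>\<alpha>\<in>S. f \<bullet> w \<alpha> = 0)"
  using S w
proof (induction S)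
  case empty
  have "w \<mu> \<in> carrier_vec n" "w \<mu> \<noteq> 0\<^sub>v n"
    using A empty by (auto simp: eigenvector_def mats_over_iff)
  \<comment> \<open>With nothing to annihilate, a coordinate functional that sees a nonzero entry
    suffices.\<close>
  then obtain i where i: "i < n" "w \<mu> $ i \<noteq> 0" by (metis eq_vecI carrier_vecD index_zero_vec)
  moreover have "unit_vec n i \<in> vecs_over K n"
    by (auto simp: vecs_over_iff unit_vec_def intro: subfield_closed)
  ultimately show ?case using \<open>w \<mu> \<in> carrier_vec n\<close>
    by (intro bexI[of _ "unit_vec n i"]) (auto simp: scalar_prod_left_unit)
next
  case (insert \<nu> S)
  have Ac: "A \<in> carrier_mat n n" using A by (simp add: mats_over_iff)
  obtain f where f: "f \<in> vecs_over K n" "f \<bullet> w \<mu> \<noteq> 0" "\<forall>\<alpha>\<in>S. f \<bullet> w \<alpha> = 0"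
    using insert.IH insert.prems by auto
  define g where "g = transpose_mat A *\<^sub>v f - \<nu> \<cdot>\<^sub>v f"
  have At: "transpose_mat A \<in> mats_over K n" using A by (auto simp: mats_over_iff)
  have fc: "f \<in> carrier_vec n" using f by (simp add: vecs_over_iff)
  have "g \<bullet> w \<alpha> = (\<alpha> - \<nu>) * (f \<bullet> w \<alpha>)" if "\<alpha> \<in> insert \<mu> (insert \<nu> S)" for \<alpha>
  proof -
    have wc: "w \<alpha> \<in> carrier_vec n" and Aw: "A *\<^sub>v w \<alpha> = \<alpha> \<cdot>\<^sub>v w \<alpha>"
      using insert.prems(3)[OF that] Ac by (auto simp: eigenvector_def)
    have "g \<bullet> w \<alpha> = (transpose_mat A *\<^sub>v f) \<bullet> w \<alpha> - (\<nu> \<cdot>\<^sub>v f) \<bullet> w \<alpha>"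
      unfolding g_def by (rule minus_scalar_prod_distrib) (use Ac fc wc in auto)
    also have "(transpose_mat A *\<^sub>v f) \<bullet> w \<alpha> = f \<bullet> (A *\<^sub>v w \<alpha>)"
      using transpose_vec_mult_scalar[OF Ac wc fc] by simp
    also have "\<dots> = \<alpha> * (f \<bullet> w \<alpha>)" unfolding Aw using fc wc by simp
    finally show ?thesis using fc wc by (simp add: algebra_simps)
  qed
  moreover have "g \<in> vecs_over K n"
    using mult_mat_vec_over[OF At f(1)] f(1) insert.prems Ac
    by (auto simp: g_def vecs_over_iff intro!: subfield_closed)
  ultimately show ?case using f insert.prems by (intro bexI[of _ g]) auto
qed

text \<open>As in Lagrange interpolation: for each \<mu> take a functional vanishing on the other
  eigenvectors, normalise it on \<open>w \<mu>\<close>, and sum with weights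
  \<open>c \<mu>\<close>.\<close>

lemma functional_with_prescribed_values:
  assumes A: "A \<in> mats_over K n" and w: "\<And>\<alpha>. \<alpha> \<in> S \<Longrightarrow> w \<alpha> \<in> vecs_over K n \<and> eigenvector A (w \<alpha>) \<alpha>"
    and S: "finite S" "S \<subseteq> K" and c: "\<And>\<alpha>. \<alpha> \<in> S \<Longrightarrow> c \<alpha> \<in> K"
  shows "\<exists>v \<in> vecs_over K n. \<forall>\<alpha>\<in>S. v \<bullet> w \<alpha> = c \<alpha>"
proof -
  have "\<exists>f \<in> vecs_over K n. f \<bullet> w \<mu> \<noteq> 0 \<and> (\<forall>\<alpha>\<in>S - {\<mu>}. f \<bullet> w \<alpha> = 0)" if "\<mu> \<in> S" for \<mu>
    by (rule separating_functional[OF A]) (use w S that in auto)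
  then obtain f where f: "\<And>\<mu>. \<mu> \<in> S \<Longrightarrow> f \<mu> \<in> vecs_over K n" "\<And>\<mu>. \<mu> \<in> S \<Longrightarrow> f \<mu> \<bullet> w \<mu> \<noteq> 0"
    "\<And>\<mu> \<alpha>. \<mu> \<in> S \<Longrightarrow> \<alpha> \<in> S \<Longrightarrow> \<alpha> \<noteq> \<mu> \<Longrightarrow> f \<mu> \<bullet> w \<alpha> = 0" by (metis Diff_iff singletonD)
  define v where "v = vec n (\<lambda>k. \<Sum>\<mu>\<in>S. c \<mu> / (f \<mu> \<bullet> w \<mu>) * f \<mu> $ k)"
  have "v \<bullet> w \<alpha> = c \<alpha>" if \<alpha>: "\<alpha> \<in> S" for \<alpha>
  proof -
    have wl: "w \<alpha> \<in> carrier_vec n" using w \<alpha> by (simp add: vecs_over_iff)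
    have "v \<bullet> w \<alpha> = (\<Sum>\<mu>\<in>S. c \<mu> / (f \<mu> \<bullet> w \<mu>) * (f \<mu> \<bullet> w \<alpha>))"
      unfolding scalar_prod_def[of _ "w \<alpha>"] v_def
      using wl by (auto simp: sum_distrib_right sum_distrib_left mult.assoc sum.swap[of _ S])
    also have "\<dots> = (\<Sum>\<mu>\<in>S. if \<mu> = \<alpha> then c \<alpha> else 0)"
      by (rule sum.cong) (use f \<alpha> in auto)
    finally show ?thesis using S \<alpha> by simp
  qed
  moreover have "v \<in> vecs_over K n"
    using f(1) c w by (auto simp: v_def vecs_over_iff
      intro!: sum_in_subfield subfield_closed scalar_prod_in_subfield[of _ n, unfolded vecs_over_iff])
  ultimately show ?thesis by blast
qed

end

section \<open>Eigenvector decomposition from a diagonalization\<close>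

text \<open>The columns of \<open>P\<close> are eigenvectors of \<open>B\<close>, and
  \<open>Q *\<^sub>v u\<close> lists the coordinates of \<open>u\<close> in this basis because P Q =
  I.\<close>

lemma diagonal_decomposition:
  fixes B :: "complex mat"
  assumes sim: "similar_mat_wit B D P Q" and B: "B \<in> carrier_mat n n" and D: "diagonal_mat D"
    and u: "u \<in> carrier_vec n"
  defines "w \<equiv> \<lambda>i. (Q *\<^sub>v u) $ i \<cdot>\<^sub>v col P i"
  shows "i < n \<Longrightarrow> B *\<^sub>v w i = D $$ (i,i) \<cdot>\<^sub>v w i"
    and "u = vec n (\<lambda>k. \<Sum>i = 0..<n. w i $ k)"
    and "i < n \<Longrightarrow> poly (char_poly B) (D $$ (i,i)) = 0"
proof -
  have c: "D \<in> carrier_mat n n" "P \<in> carrier_mat n n" "Q \<in> carrier_mat n n"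
    and PQ: "P * Q = 1\<^sub>m n" and QP: "Q * P = 1\<^sub>m n" and BPDQ: "B = P * D * Q"
    using sim B unfolding similar_mat_wit_def Let_def by auto
  have "B * P = P * D * (Q * P)" unfolding BPDQ using c by (intro assoc_mult_mat) auto
  then have BP: "B * P = P * D" using c by (simp add: QP)
  have Dcol: "col D i = D $$ (i,i) \<cdot>\<^sub>v unit_vec n i" if "i < n" for i
    using that c D by (intro eq_vecI) (auto simp: diagonal_mat_def unit_vec_def)
  have Pu: "P *\<^sub>v unit_vec n i = col P i" if "i < n" for i
    using that c by (intro eq_vecI) auto
  have Bcol: "B *\<^sub>v col P i = D $$ (i,i) \<cdot>\<^sub>v col P i" if i: "i < n" for i
  proof -
    have "B *\<^sub>v col P i = col (B * P) i" by (rule col_mult2[OF B c(2) i, symmetric])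
    also have "\<dots> = P *\<^sub>v (D $$ (i,i) \<cdot>\<^sub>v unit_vec n i)"
      unfolding BP Dcol[OF i, symmetric] by (rule col_mult2[OF c(2,1) i])
    also have "\<dots> = D $$ (i,i) \<cdot>\<^sub>v (P *\<^sub>v unit_vec n i)" using c by (intro mult_mat_vec) auto
    finally show ?thesis by (simp add: Pu i)
  qed
  show "B *\<^sub>v w i = D $$ (i,i) \<cdot>\<^sub>v w i" if i: "i < n"
  proof -
    have "B *\<^sub>v w i = (Q *\<^sub>v u) $ i \<cdot>\<^sub>v (B *\<^sub>v col P i)"
      unfolding w_def using B c i by (intro mult_mat_vec) auto
    then show ?thesis using i by (simp add: Bcol w_def smult_smult_assoc mult.commute)
  qed
  show "u = vec n (\<lambda>k. \<Sum>i = 0..<n. w i $ k)"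
  proof -
    have "u = P *\<^sub>v (Q *\<^sub>v u)" using c u PQ by (metis assoc_mult_mat_vec one_mult_mat_vec)
    also have "\<dots> = vec n (\<lambda>k. \<Sum>i = 0..<n. w i $ k)"
      using c u by (intro eq_vecI)
        (auto simp: w_def scalar_prod_def[of "row P _"] mult.commute intro!: sum.cong)
    finally show ?thesis .
  qed
  \<comment> \<open>\<open>w i\<close> can be zero when \<open>u\<close> has no component along
    column \<open>i\<close>, so the column itself serves as eigenvector; \<open>Q\<close> maps it to
    a unit vector, hence it is nonzero.\<close>
  show "poly (char_poly B) (D $$ (i,i)) = 0" if i: "i < n"
  proof -
    have "Q *\<^sub>v col P i = unit_vec n i"
      using i c QP by (metis col_mult2 col_one)
    moreover have "Q *\<^sub>v 0\<^sub>v n = 0\<^sub>v n" using c by auto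
    moreover have "unit_vec n i \<noteq> (0\<^sub>v n :: complex vec)" using i
      by (metis index_unit_vec(2) index_zero_vec(1) zero_neq_one)
    ultimately have "col P i \<noteq> 0\<^sub>v n" by metis
    then have "eigenvector B (col P i) (D $$ (i,i))"
      using Bcol[OF i] B c i by (auto simp: eigenvector_def)
    then show ?thesis using eigenvalue_root_char_poly[OF B] by (auto simp: eigenvalue_def)
  qed
qed

section \<open>Transfer of the integral from \<open>B\<close> to \<open>B'\<close>\<close>

lemma poly_eqI_cofinite:
  fixes p q :: "'a :: {idom, ring_char_0} poly"
  assumes "finite S" "\<And>x. x \<notin> S \<Longrightarrow> poly p x = poly q x"
  shows "p = q"
proof (rule ccontr)
  assume "p \<noteq> q"
  then have "finite {x. poly (p - q) x = 0}" by (intro poly_roots_finite) simp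
  moreover have "- S \<subseteq> {x. poly (p - q) x = 0}" using assms by auto
  ultimately have "finite (- S)" by (rule rev_finite_subset)
  then show False using assms(1) infinite_UNIV_char_0[where 'a='a]
    by (metis finite_UnI Compl_partition)
qed

theorem theorem4p12:
  fixes K :: "complex set" and n :: nat and B B' :: "complex mat"
  assumes "alg_closed_subfield K"
    and "B \<in> mats_over K n" and "diagonalizable_over K n B"
    and "B' \<in> mats_over K n" and "char_poly B' = char_poly B"
    and "integrable_mat K n B"
  shows "integrable_mat K n B'"
proof -
  note K = assms(1) and clo = subfield_closed[OF assms(1)]
  have B: "B \<in> carrier_mat n n" and B': "B' \<in> carrier_mat n n"
    using assms by (auto simp: mats_over_iff)
  obtain D P Q where D: "D \<in> mats_over K n" and P: "P \<in> mats_over K n" and Q: "Q \<in> mats_over K n"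
    and diag: "diagonal_mat D" and sim: "similar_mat_wit B D P Q"
    using assms(3) unfolding diagonalizable_over_def by blast
  obtain u v b where u: "u \<in> vecs_over K n" and v: "v \<in> vecs_over K n" and b: "b \<in> K"
    and int: "char_poly B = Polynomial.smult (1 / of_nat (n + 1)) (pderiv (char_poly (bordered B u v b)))"
    using assms(6) unfolding integrable_mat_def is_integral_def by blast
  have uc: "u \<in> carrier_vec n" and vc: "v \<in> carrier_vec n" using u v by (auto simp: vecs_over_iff)
  define x where "x i = (Q *\<^sub>v u) $ i \<cdot>\<^sub>v col P i" for i
  define d where "d i = D $$ (i,i)" for i
  define S where "S = d ` {0..<n}"
  \<comment> \<open>The coefficient of 1/(t - \<alpha>) in the correction term for \<open>B\<close>,
    collected over all columns with eigenvalue \<alpha>.\<close>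
  define c where "c = (\<lambda>\<alpha>. \<Sum>i\<in>{i \<in> {0..<n}. d i = \<alpha>}. v \<bullet> x i)"
  note dec = diagonal_decomposition[OF sim B diag uc, folded x_def d_def]
  have x: "x i \<in> vecs_over K n" if "i < n" for i
    using mult_mat_vec_over[OF K Q u] P that
    by (auto simp: x_def vecs_over_iff mats_over_iff intro!: clo)
  have S: "finite S" "S \<subseteq> K" using D by (auto simp: S_def d_def mats_over_iff)
  have "\<exists>w \<in> vecs_over K n. eigenvector B' w \<alpha>" if "\<alpha> \<in> S" for \<alpha>
    by (rule eigenvector_over[OF K assms(4)]) (use that S dec(3) assms(5) in \<open>auto simp: S_def\<close>)
  then obtain w where w: "\<And>\<alpha>. \<alpha> \<in> S \<Longrightarrow> w \<alpha> \<in> vecs_over K n \<and> eigenvector B' (w \<alpha>) \<alpha>" by metis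
  have "\<exists>v' \<in> vecs_over K n. \<forall>\<alpha>\<in>S. v' \<bullet> w \<alpha> = c \<alpha>"
    by (rule functional_with_prescribed_values[OF K assms(4) w S])
      (auto simp: c_def intro!: sum_in_subfield[OF K] scalar_prod_in_subfield[OF K v] x)
  then obtain v' where v': "v' \<in> vecs_over K n" "\<And>\<alpha>. \<alpha> \<in> S \<Longrightarrow> v' \<bullet> w \<alpha> = c \<alpha>" by blast
  define u' where "u' = vec n (\<lambda>k. \<Sum>\<alpha>\<in>S. w \<alpha> $ k)"
  have u': "u' \<in> vecs_over K n"
    using w by (auto simp: u'_def vecs_over_iff intro!: sum_in_subfield[OF K])
  \<comment> \<open>With the corner \<open>b\<close> unchanged, equality of these polynomials
    carries the derivative condition from \<open>B\<close> to \<open>B'\<close>, as \<open>B\<close>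
    and \<open>B'\<close> share their characteristic polynomial. The bordering formula holds off the
    finite set \<open>S\<close>, which is enough for equality.\<close>
  have "char_poly (bordered B' u' v' b) = char_poly (bordered B u v b)"
  proof (rule poly_eqI_cofinite[OF S(1)])
    fix t assume t: "t \<notin> S"
    have "poly (char_poly (bordered B' u' v' b)) t
        = poly (char_poly B') t * (t - b - (\<Sum>\<alpha>\<in>S. (v' \<bullet> w \<alpha>) / (t - \<alpha>)))"
      unfolding u'_def using poly_char_poly_bordered[OF B', of v' S w "\<lambda>\<alpha>. \<alpha>" t b] w v' S t B'
      by (auto simp: eigenvector_def vecs_over_iff)
    also have "(\<Sum>\<alpha>\<in>S. (v' \<bullet> w \<alpha>) / (t - \<alpha>))
        = (\<Sum>\<alpha>\<in>S. \<Sum>i\<in>{i \<in> {0..<n}. d i = \<alpha>}. (v \<bullet> x i) / (t - d i))"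
      by (rule sum.cong) (auto simp: v' c_def sum_divide_distrib)
    \<comment> \<open>Regrouping by the fibres of \<open>d\<close> undoes the collection of repeated
      eigenvalues in \<open>c\<close>.\<close>
    also have "\<dots> = (\<Sum>i = 0..<n. (v \<bullet> x i) / (t - d i))"
      unfolding S_def by (rule sum.image_gen[symmetric]) simp
    also have "poly (char_poly B') t * (t - b - \<dots>) = poly (char_poly (bordered B u v b)) t"
      using poly_char_poly_bordered[OF B vc, of "{0..<n}" x d t b] x dec(1) dec(2)[symmetric] t
      by (simp add: S_def assms(5) vecs_over_iff)
    finally show "poly (char_poly (bordered B' u' v' b)) t
      = poly (char_poly (bordered B u v b)) t" .
  qed
  moreover have "bordered B' u' v' b \<in> mats_over K (n + 1)"
    using assms(4) u' v'(1) b
    by (auto simp: bordered_def mats_over_iff vecs_over_iff mat_of_row_def)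
  ultimately have "is_integral K n B' (bordered B' u' v' b)"
    using u' v'(1) b int unfolding is_integral_def assms(5) by auto
  then show ?thesis unfolding integrable_mat_def by blast
qed

end
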